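(* Let $1<\alpha<2$. Let $d_+,d_-$ be nonnegative functions on $[x_L,x_R]$ with $d_+>0$, put $\tilde d(x)=d_-(x)/d_+(x)$, and suppose that $0\le\kappa_{min}\le\tilde d(x)\le\kappa_{max}<\infty$ on $[x_L,x_R]$ for constants $\kappa_{min},\kappa_{max}$, and that $\tilde d$ is concave or convex on $[x_L,x_R]$. Let $\kappa=\kappa_{max}$ when $\tilde d$ is concave, and $\kappa=\kappa_{min}$ when $\tilde d$ is convex. Let $A_\alpha=W_\alpha+\tilde D W_\alpha^T$, where $\tilde D=\mathrm{diag}(\tilde d(x_1),\dots,\tilde d(x_{M-1}))$. If $$1+\kappa-\frac{\sqrt{2}\,(\kappa_{max}-\kappa_{min})}{\varsigma_\alpha}\ge 0,$$ then the symmetric part $\mathcal{H}(A_\alpha)=\frac12(A_\alpha+A_\alpha^T)$ of $A_\alpha$ is negative semidefinite.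
   Context: $M$ is a positive integer, $h=(x_R-x_L)/M$, and the grid points are $x_i=x_L+ih$, $0\le i\le M$. Define $g_0^{(\alpha)}=1$, $g_k^{(\alpha)}=\big(1-\frac{\alpha+1}{k}\big)g_{k-1}^{(\alpha)}$ for $k\ge 1$, and $$w_0^{(\alpha)}=\frac{\alpha}{2}g_0^{(\alpha)},\qquad w_k^{(\alpha)}=\frac{\alpha}{2}g_k^{(\alpha)}+\frac{2-\alpha}{2}g_{k-1}^{(\alpha)}\quad (k\ge 1).$$ $W_\alpha$ is the $(M-1)\times(M-1)$ Toeplitz matrix with entries $(W_\alpha)_{ij}=w_{i-j+1}^{(\alpha)}$ if $i-j+1\ge 0$ and $(W_\alpha)_{ij}=0$ otherwise. With $g(\alpha,x)=\sum_{k=0}^{\infty}w_k^{(\alpha)}e^{\mathbf{i}(k-1)x}$ the generating function of $W_\alpha$, the constant $\varsigma_\alpha$ is $$\varsigma_\alpha=\inf_{x\in[-\pi,\pi]\setminus\{0\}}\frac{\Re[-g(\alpha,x)]}{|g(\alpha,x)|}=\Big|\cos\Big(\frac{\alpha}{2}\pi\Big)\Big|.$$ In terms of $D_\pm=\mathrm{diag}(d_\pm(x_1),\dots,d_\pm(x_{M-1}))$ and $A=D_+W_\alpha+D_-W_\alpha^T$, one has $\tilde D=D_+^{-1}D_-$ and $A_\alpha=D_+^{-1}A$. If $\tilde d$ is both concave and convex (affine), either choice of $\kappa$ is allowed. *)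

theory Defs
  imports "HOL-Analysis.Analysis" "Jordan_Normal_Form.Matrix"
begin

(* Below, the dot is scalar_prod of Jordan_Normal_Form. *)
no_notation inner (infix "\<bullet>" 70)

definition grid_point :: "real \<Rightarrow> real \<Rightarrow> nat \<Rightarrow> nat \<Rightarrow> real" where
  "grid_point xL xR M i = xL + real i * ((xR - xL) / real M)"

fun gl_coeff :: "real \<Rightarrow> nat \<Rightarrow> real" where
  "gl_coeff \<alpha> 0 = 1"
| "gl_coeff \<alpha> (Suc k) = (1 - (\<alpha> + 1) / real (Suc k)) * gl_coeff \<alpha> k"

fun w_coeff :: "real \<Rightarrow> nat \<Rightarrow> real" where
  "w_coeff \<alpha> 0 = \<alpha> / 2 * gl_coeff \<alpha> 0"
| "w_coeff \<alpha> (Suc k) = \<alpha> / 2 * gl_coeff \<alpha> (Suc k) + (2 - \<alpha>) / 2 * gl_coeff \<alpha> k"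

(* Matrix indices start at 0, which leaves i - j unchanged.  The guard is i - j + 1 \<ge> 0, under
   which the subtraction of naturals is exact. *)
definition W_mat :: "real \<Rightarrow> nat \<Rightarrow> real mat" where
  "W_mat \<alpha> M = mat (M - 1) (M - 1)
     (\<lambda>(i, j). if j \<le> i + 1 then w_coeff \<alpha> (i + 1 - j) else 0)"

definition gen_fun :: "real \<Rightarrow> real \<Rightarrow> complex" where
  "gen_fun \<alpha> x = (\<Sum>k. of_real (w_coeff \<alpha> k) * exp (\<i> * of_real ((real k - 1) * x)))"

definition varsigma :: "real \<Rightarrow> real" where
  "varsigma \<alpha> = (INF x \<in> {-pi..pi} - {0}. Re (- gen_fun \<alpha> x) / cmod (gen_fun \<alpha> x))"

(* Row i (counted from 0) carries the grid point with index i + 1, so the diagonal runs over the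
   interior grid points 1, ..., M - 1. *)
definition D_mat :: "real \<Rightarrow> real \<Rightarrow> nat \<Rightarrow> (real \<Rightarrow> real) \<Rightarrow> real mat" where
  "D_mat xL xR M d = mat_diag (M - 1) (\<lambda>i. d (grid_point xL xR M (i + 1)))"

definition A_mat :: "real \<Rightarrow> real \<Rightarrow> real \<Rightarrow> nat \<Rightarrow> (real \<Rightarrow> real) \<Rightarrow> real mat" where
  "A_mat \<alpha> xL xR M d = W_mat \<alpha> M + D_mat xL xR M d * transpose_mat (W_mat \<alpha> M)"

definition sym_part :: "real mat \<Rightarrow> real mat" where
  "sym_part A = (1 / 2) \<cdot>\<^sub>m (A + transpose_mat A)"

definition neg_semidef :: "nat \<Rightarrow> real mat \<Rightarrow> bool" where
  "neg_semidef n A \<longleftrightarrow> A \<in> carrier_mat n n \<and> transpose_mat A = A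
     \<and> (\<forall>v \<in> carrier_vec n. v \<bullet> (A *\<^sub>v v) \<le> 0)"

end

theory Submission
  imports Defs
begin

text \<open>
Write \<open>B u v\<close> for the bilinear form of \<open>W\<^sub>\<alpha>\<close> and \<open>Q v = - B v v\<close>. In the concave case put
\<open>e = \<kappa>\<^sub>m\<^sub>a\<^sub>x - d\<close> and \<open>\<sigma> = -1\<close>, in the convex case \<open>e = d - \<kappa>\<^sub>m\<^sub>i\<^sub>n\<close> and \<open>\<sigma> = 1\<close>, where \<open>d\<close> is the
coefficient ratio. Either way \<open>d = \<kappa> + \<sigma> e\<close> with \<open>e\<close> convex and \<open>0 \<le> e \<le> K\<close> for
\<open>K = \<kappa>\<^sub>m\<^sub>a\<^sub>x - \<kappa>\<^sub>m\<^sub>i\<^sub>n\<close>, and the quadratic form of \<open>A\<^sub>\<alpha>\<close> is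
\<open>- (1 + \<kappa>) Q v + \<sigma> B v (e v)\<close>. Everything therefore rests on bounding \<open>\<bar>B v (e v)\<bar>\<close> by
\<open>\<surd>2 K Q v / \<varsigma>\<^sub>\<alpha>\<close>, which combines two independent facts.

The first is a Cauchy-Schwarz inequality for the nonsymmetric form, in the shape
\<open>2 \<varsigma>\<^sub>\<alpha> \<bar>B u v\<bar> \<le> Q u + Q v\<close> (lemma \<open>sectorial_symbol_bound\<close>). By Fourier inversion
\<open>B u v\<close> is the integral of the generating function against two trigonometric polynomials, and
\<open>\<varsigma>\<^sub>\<alpha> \<bar>g\<bar> \<le> Re (- g)\<close> holds pointwise by definition of \<open>\<varsigma>\<^sub>\<alpha>\<close>. That \<open>\<varsigma>\<^sub>\<alpha>\<close> is
positive, so that the division in the hypothesis is meaningful, comes from the closed form of \<open>g\<close>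
through the binomial series of \<open>(1 - z)\<^sup>\<alpha>\<close> on the unit circle (lemmas \<open>symbol_eq_powr\<close>,
\<open>symbol_sector_pos\<close>).

The second is \<open>Q (e v) \<le> 2 K\<^sup>2 Q v\<close> (lemma \<open>toeplitz_form_convex_mult\<close>), which is where convexity
enters and where the factor \<open>\<surd>2\<close> comes from. Because the weights sum to zero and
the off-diagonal ones are nonnegative after symmetrization, \<open>Q\<close> is a Dirichlet energy: weighted
squared differences plus a nonnegative killing term that represents the jumps leaving the grid.
Apart from a term that contains the Laplacian of \<open>e\<close>, the energy \<open>Q (e v)\<close> is at most \<open>K\<^sup>2 Q v\<close>. On
the whole line the Laplacian of a convex sequence would have a favourable sign; on a finite grid the
missing neighbours spoil this by at most \<open>K\<close> times the killing rate, which costs the second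
\<open>K\<^sup>2 Q v\<close>.

The Cauchy-Schwarz inequality is then applied to \<open>\<surd>2 K v\<close> and \<open>e v\<close>, whose energies are
both at most \<open>2 K\<^sup>2 Q v\<close> (lemma \<open>perturbed_form_le_0\<close>).
\<close>

section \<open>Dirichlet energies under multiplication by a convex sequence\<close>

text \<open>
The square of a difference of products splits as
\<open>(e\<^sub>i v\<^sub>i - e\<^sub>j v\<^sub>j)\<^sup>2 = e\<^sub>i e\<^sub>j (v\<^sub>i - v\<^sub>j)\<^sup>2 + (e\<^sub>i - e\<^sub>j) (e\<^sub>i v\<^sub>i\<^sup>2 - e\<^sub>j v\<^sub>j\<^sup>2)\<close>. Summed against symmetric weights,
the last term pairs \<open>e v\<^sup>2\<close> with the Laplacian of \<open>e\<close>, which the hypothesis \<open>subharmonic\<close> bounds by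
the killing rate \<open>r\<close>. Thus the killing part of the energy is paid twice, once here and once for
itself, and the difference part once.
\<close>

lemma dirichlet_energy_mult_le:
  fixes C :: "'a \<Rightarrow> 'a \<Rightarrow> real" and e r v :: "'a \<Rightarrow> real"
  assumes C_nonneg: "\<And>i j. i \<in> I \<Longrightarrow> j \<in> I \<Longrightarrow> 0 \<le> C i j"
    and C_sym: "\<And>i j. i \<in> I \<Longrightarrow> j \<in> I \<Longrightarrow> C i j = C j i"
    and r_nonneg: "\<And>i. i \<in> I \<Longrightarrow> 0 \<le> r i"
    and e: "\<And>i. i \<in> I \<Longrightarrow> 0 \<le> e i \<and> e i \<le> K"
    and subharmonic: "\<And>i. i \<in> I \<Longrightarrow> (\<Sum>j\<in>I. C i j * (e i - e j)) \<le> K * r i"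
  defines "E \<equiv> \<lambda>u. (\<Sum>i\<in>I. \<Sum>j\<in>I. C i j * (u i - u j)\<^sup>2) / 2 + (\<Sum>i\<in>I. r i * (u i)\<^sup>2)"
  shows "E (\<lambda>i. e i * v i) \<le> 2 * K\<^sup>2 * E v"
proof -
  let ?cross = "\<Sum>i\<in>I. \<Sum>j\<in>I. C i j * ((e i - e j) * (e i * (v i)\<^sup>2 - e j * (v j)\<^sup>2))"
  have square: "(e i * v i - e j * v j)\<^sup>2
      = e i * e j * (v i - v j)\<^sup>2 + (e i - e j) * (e i * (v i)\<^sup>2 - e j * (v j)\<^sup>2)" for i j
    by (simp add: power2_eq_square algebra_simps)
  have pairs: "(\<Sum>i\<in>I. \<Sum>j\<in>I. C i j * (e i * v i - e j * v j)\<^sup>2)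
      = (\<Sum>i\<in>I. \<Sum>j\<in>I. C i j * (e i * e j * (v i - v j)\<^sup>2)) + ?cross"
    by (simp add: square distrib_left sum.distrib)
  have main: "(\<Sum>i\<in>I. \<Sum>j\<in>I. C i j * (e i * e j * (v i - v j)\<^sup>2))
      \<le> K\<^sup>2 * (\<Sum>i\<in>I. \<Sum>j\<in>I. C i j * (v i - v j)\<^sup>2)"
  proof -
    have "C i j * (e i * e j * (v i - v j)\<^sup>2) \<le> K\<^sup>2 * (C i j * (v i - v j)\<^sup>2)"
      if "i \<in> I" "j \<in> I" for i j
    proof -
      have "e i * e j \<le> K * K"
        using e[OF that(1)] e[OF that(2)] by (intro mult_mono) auto
      then have "(e i * e j) * (C i j * (v i - v j)\<^sup>2) \<le> (K * K) * (C i j * (v i - v j)\<^sup>2)"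
        using C_nonneg[OF that] by (intro mult_right_mono) auto
      then show ?thesis by (simp add: power2_eq_square algebra_simps)
    qed
    then show ?thesis by (auto simp: sum_distrib_left intro!: sum_mono)
  qed
  have cross: "?cross \<le> 2 * (K\<^sup>2 * (\<Sum>i\<in>I. r i * (v i)\<^sup>2))"
  proof -
    let ?S = "\<Sum>i\<in>I. \<Sum>j\<in>I. C i j * (e i - e j) * (e i * (v i)\<^sup>2)"
    have "?S = (\<Sum>i\<in>I. \<Sum>j\<in>I. C j i * (e j - e i) * (e j * (v j)\<^sup>2))"
      by (rule sum.swap)
    also have "\<dots> = (\<Sum>i\<in>I. \<Sum>j\<in>I. C i j * (e j - e i) * (e j * (v j)\<^sup>2))"
      by (intro sum.cong refl) (simp add: C_sym)
    \<comment> \<open>Exchanging \<open>i\<close> and \<open>j\<close> shows that both halves of the cross term are equal.\<close>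
    finally have "?cross = 2 * ?S"
      by (simp add: algebra_simps sum.distrib sum_subtractf)
    moreover have "?S \<le> K\<^sup>2 * (\<Sum>i\<in>I. r i * (v i)\<^sup>2)"
    proof -
      have "(\<Sum>j\<in>I. C i j * (e i - e j) * (e i * (v i)\<^sup>2)) \<le> K\<^sup>2 * (r i * (v i)\<^sup>2)"
        if i: "i \<in> I" for i
      proof -
        have "(\<Sum>j\<in>I. C i j * (e i - e j)) * (e i * (v i)\<^sup>2) \<le> (K * r i) * (e i * (v i)\<^sup>2)"
          using subharmonic[OF i] e[OF i] by (intro mult_right_mono) auto
        also have "\<dots> \<le> (K * r i) * (K * (v i)\<^sup>2)"
          using e[OF i] r_nonneg[OF i] by (intro mult_left_mono mult_right_mono) auto
        finally show ?thesis
          unfolding sum_distrib_right power2_eq_square[of K] by (simp only: mult_ac)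
      qed
      then show ?thesis by (auto simp: sum_distrib_left intro!: sum_mono)
    qed
    ultimately show ?thesis by simp
  qed
  have killing: "(\<Sum>i\<in>I. r i * (e i * v i)\<^sup>2) \<le> K\<^sup>2 * (\<Sum>i\<in>I. r i * (v i)\<^sup>2)"
  proof -
    have "r i * (e i * v i)\<^sup>2 \<le> K\<^sup>2 * (r i * (v i)\<^sup>2)" if i: "i \<in> I" for i
    proof -
      have "(e i)\<^sup>2 * (r i * (v i)\<^sup>2) \<le> K\<^sup>2 * (r i * (v i)\<^sup>2)"
        using e[OF i] r_nonneg[OF i] by (intro mult_right_mono power_mono) auto
      then show ?thesis by (simp add: power_mult_distrib algebra_simps)
    qed
    then show ?thesis by (auto simp: sum_distrib_left intro!: sum_mono)
  qed
  have nonneg: "0 \<le> K\<^sup>2 * (\<Sum>i\<in>I. \<Sum>j\<in>I. C i j * (v i - v j)\<^sup>2)"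
    by (intro mult_nonneg_nonneg sum_nonneg) (auto simp: C_nonneg)
  have "a \<le> k * p \<Longrightarrow> b \<le> 2 * (k * q) \<Longrightarrow> c \<le> k * q \<Longrightarrow> 0 \<le> k * p
      \<Longrightarrow> (a + b) / 2 + c \<le> 2 * k * (p / 2 + q)" for a b c k p q :: real
    by (simp add: field_simps)
  from this[OF main cross killing nonneg] show ?thesis unfolding E_def pairs .
qed

lemma sum_by_distance:
  fixes f :: "nat \<Rightarrow> real"
  assumes i: "i < n"
  shows "(\<Sum>j\<in>{..<n} - {i}. f j)
    = (\<Sum>k\<in>{1..n}. (if k \<le> i then f (i - k) else 0) + (if i + k < n then f (i + k) else 0))"
proof -
  have split: "{..<n} - {i} = {..<i} \<union> {i<..<n}" using i by auto
  have "(\<Sum>j\<in>{..<n} - {i}. f j) = (\<Sum>j\<in>{..<i}. f j) + (\<Sum>j\<in>{i<..<n}. f j)"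
    unfolding split by (rule sum.union_disjoint) auto
  also have "(\<Sum>j\<in>{..<i}. f j) = (\<Sum>k\<in>{k\<in>{1..n}. k \<le> i}. f (i - k))"
    using i by (intro sum.reindex_bij_witness[of _ "\<lambda>k. i - k" "\<lambda>j. i - j"]) auto
  also have "(\<Sum>j\<in>{i<..<n}. f j) = (\<Sum>k\<in>{k\<in>{1..n}. i + k < n}. f (i + k))"
    by (intro sum.reindex_bij_witness[of _ "\<lambda>k. i + k" "\<lambda>j. j - i"]) auto
  also have "(\<Sum>k\<in>{k\<in>{1..n}. k \<le> i}. f (i - k)) = (\<Sum>k\<in>{1..n}. if k \<le> i then f (i - k) else 0)"
    by (rule sum.inter_filter) simp
  also have "(\<Sum>k\<in>{k\<in>{1..n}. i + k < n}. f (i + k))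
      = (\<Sum>k\<in>{1..n}. if i + k < n then f (i + k) else 0)"
    by (rule sum.inter_filter) simp
  finally show ?thesis by (simp add: sum.distrib)
qed

text \<open>Lags that reach outside \<open>{..<n}\<close> are exempt, so this is convexity of a finite sequence.\<close>

definition midpoint_convex :: "nat \<Rightarrow> (nat \<Rightarrow> real) \<Rightarrow> bool" where
  "midpoint_convex n e \<longleftrightarrow> (\<forall>i k. k \<le> i \<and> i + k < n \<longrightarrow> 2 * e i \<le> e (i - k) + e (i + k))"

text \<open>
The two positions at distance \<open>k\<close> from \<open>i\<close> are treated together. If both lie in the range,
convexity makes their joint contribution \<open>c\<^sub>k (2 e\<^sub>i - e\<^sub>i\<^sub>-\<^sub>k - e\<^sub>i\<^sub>+\<^sub>k)\<close> nonpositive. If only one does, it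
contributes at most \<open>K c\<^sub>k\<close>, and the missing one leaves the mass \<open>c\<^sub>k\<close> in the killing rate, the
factor of \<open>K\<close> on the right-hand side.
\<close>

lemma convex_seq_almost_subharmonic:
  fixes c :: "nat \<Rightarrow> real"
  assumes i: "i < n"
    and c: "\<And>k. 1 \<le> k \<Longrightarrow> 0 \<le> c k"
    and e: "\<And>j. j < n \<Longrightarrow> 0 \<le> e j \<and> e j \<le> K"
    and convex: "midpoint_convex n e"
    and mass: "2 * (\<Sum>k\<in>{1..n}. c k) \<le> m"
  shows "(\<Sum>j\<in>{..<n} - {i}. c ((i - j) + (j - i)) * (e i - e j))
    \<le> K * (m - (\<Sum>j\<in>{..<n} - {i}. c ((i - j) + (j - i))))"
proof -
  have K: "0 \<le> K" using e[OF i] by simp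
  \<comment> \<open>The killing rate is moved to the left, where it turns each difference into \<open>e i - e j + K\<close>.\<close>
  have "(\<Sum>j\<in>{..<n} - {i}. c ((i - j) + (j - i)) * (e i - e j + K))
      = (\<Sum>k\<in>{1..n}. (if k \<le> i then c k * (e i - e (i - k) + K) else 0)
          + (if i + k < n then c k * (e i - e (i + k) + K) else 0))"
    unfolding sum_by_distance[OF i] by (intro sum.cong refl) auto
  also have "\<dots> \<le> (\<Sum>k\<in>{1..n}. 2 * K * c k)"
  proof (rule sum_mono)
    fix k assume k: "k \<in> {1..n}"
    have ck: "0 \<le> c k" using c k by simp
    let ?l = "if k \<le> i then e i - e (i - k) + K else 0"
    let ?r = "if i + k < n then e i - e (i + k) + K else 0"
    have "?l + ?r \<le> 2 * K"
    proof (cases "k \<le> i \<and> i + k < n")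
      case True
      then have "2 * e i \<le> e (i - k) + e (i + k)"
        using convex by (auto simp: midpoint_convex_def)
      then show ?thesis using True by simp
    next
      case False
      moreover have "i - k < n" using i by simp
      ultimately show ?thesis using e[of i] e[of "i - k"] e[of "i + k"] i K by auto
    qed
    then have "c k * (?l + ?r) \<le> c k * (2 * K)" using ck by (rule mult_left_mono)
    then show "(if k \<le> i then c k * (e i - e (i - k) + K) else 0)
        + (if i + k < n then c k * (e i - e (i + k) + K) else 0) \<le> 2 * K * c k"
      by (auto simp: algebra_simps split: if_splits)
  qed
  also have "\<dots> = K * (2 * (\<Sum>k\<in>{1..n}. c k))" by (simp add: sum_distrib_left mult_ac)
  also have "\<dots> \<le> K * m" using mass K by (rule mult_left_mono)
  finally show ?thesis
    by (simp add: algebra_simps sum.distrib sum_subtractf sum_distrib_left)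
qed

section \<open>Hessenberg Toeplitz forms\<close>

definition toeplitz_entry :: "(nat \<Rightarrow> real) \<Rightarrow> nat \<Rightarrow> nat \<Rightarrow> real" where
  "toeplitz_entry w i j = (if j \<le> i + 1 then w (i + 1 - j) else 0)"

definition toeplitz_form :: "nat \<Rightarrow> (nat \<Rightarrow> real) \<Rightarrow> (nat \<Rightarrow> real) \<Rightarrow> (nat \<Rightarrow> real) \<Rightarrow> real" where
  "toeplitz_form n w u v = (\<Sum>i<n. \<Sum>j<n. u i * toeplitz_entry w i j * v j)"

text \<open>
The common value at distance \<open>k \<ge> 1\<close> of the symmetrized Toeplitz matrix. The superdiagonal weight
\<open>w 0\<close> meets \<open>w 2\<close> at distance one; all larger distances see the lower triangle only.
\<close>

definition lag_weight :: "(nat \<Rightarrow> real) \<Rightarrow> nat \<Rightarrow> real" where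
  "lag_weight w k = (w (k + 1) + (if k = 1 then w 0 else 0)) / 2"

lemma lag_weight_nonneg:
  assumes "0 \<le> w 0 + w 2" "\<And>k. 3 \<le> k \<Longrightarrow> 0 \<le> w k" "1 \<le> k"
  shows "0 \<le> lag_weight w k"
  using assms(1) assms(2)[of "k + 1"] assms(3)
  by (cases "k = 1") (auto simp: lag_weight_def numeral_2_eq_2)

text \<open>
Since the whole weight sequence sums to zero, the diagonal \<open>- w 1\<close> is exactly twice the total mass
of all lags, which dominates any partial sum. This makes the killing rates nonnegative.
\<close>

lemma lag_weight_mass_le:
  assumes "0 \<le> w 0 + w 2" "\<And>k. 3 \<le> k \<Longrightarrow> 0 \<le> w k" "w sums 0"
  shows "2 * (\<Sum>k\<in>{1..n}. lag_weight w k) \<le> - w 1"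
proof -
  have "(\<lambda>k. w (k + 2)) sums (0 - (\<Sum>k<2. w k))"
    using assms(3) by (subst sums_iff_shift) simp
  then have "(\<lambda>k. w (k + 2) + (if k = 0 then w 0 else 0)) sums (0 - (\<Sum>k<2. w k) + w 0)"
    by (rule sums_add) (rule sums_single[of 0 "\<lambda>_. w 0"])
  moreover have "w (k + 2) + (if k = 0 then w 0 else 0) = 2 * lag_weight w (Suc k)" for k
    by (simp add: lag_weight_def)
  ultimately have sums: "(\<lambda>k. 2 * lag_weight w (Suc k)) sums (- w 1)"
    by (simp add: numeral_2_eq_2)
  have "(\<Sum>k<n. 2 * lag_weight w (Suc k)) \<le> (\<Sum>k. 2 * lag_weight w (Suc k))"
    using lag_weight_nonneg[OF assms(1,2)] sums by (intro sum_le_suminf) (auto simp: sums_iff)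
  also have "\<dots> = - w 1" using sums by (simp add: sums_iff)
  also have "(\<Sum>k<n. 2 * lag_weight w (Suc k)) = 2 * (\<Sum>k\<in>{1..n}. lag_weight w k)"
    unfolding sum_distrib_left
    by (intro sum.reindex_bij_witness[of _ "\<lambda>k. k - 1" Suc]) auto
  finally show ?thesis .
qed

text \<open>
Polarization, \<open>- 2 v\<^sub>i v\<^sub>j = (v\<^sub>i - v\<^sub>j)\<^sup>2 - v\<^sub>i\<^sup>2 - v\<^sub>j\<^sup>2\<close>, moves the off-diagonal part into squared
differences; what remains on the diagonal is the killing rate.
\<close>

lemma neg_toeplitz_form_eq_dirichlet:
  fixes w :: "nat \<Rightarrow> real" and n :: nat
  defines "C \<equiv> \<lambda>i j. if i = j then 0 else lag_weight w ((i - j) + (j - i))"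
  shows "- toeplitz_form n w v v = (\<Sum>i<n. \<Sum>j<n. C i j * (v i - v j)\<^sup>2) / 2
    + (\<Sum>i<n. (- w 1 - (\<Sum>j<n. C i j)) * (v i)\<^sup>2)"
proof -
  let ?T = "toeplitz_entry w"
  have sym: "?T i j + ?T j i = 2 * C i j + (if i = j then 2 * w 1 else 0)" for i j
  proof -
    consider "i = j" | "j = Suc i" | "i = Suc j" | "Suc i < j" | "Suc j < i" by linarith
    then show ?thesis
      by cases (auto simp: toeplitz_entry_def C_def lag_weight_def Suc_diff_le numeral_2_eq_2)
  qed
  have C_sym: "C i j = C j i" for i j by (simp add: C_def add.commute)
  have "2 * toeplitz_form n w v v = (\<Sum>i<n. \<Sum>j<n. v i * ?T i j * v j) + (\<Sum>i<n. \<Sum>j<n. v j * ?T j i * v i)"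
    using sum.swap[of "\<lambda>i j. v i * ?T i j * v j" "{..<n}" "{..<n}"] by (simp add: toeplitz_form_def)
  also have "\<dots> = (\<Sum>i<n. \<Sum>j<n. v i * v j * (?T i j + ?T j i))"
    by (simp add: sum.distrib[symmetric] algebra_simps)
  also have "\<dots> = (\<Sum>i<n. \<Sum>j<n. 2 * (C i j * v i * v j) + (if i = j then 2 * w 1 * (v i)\<^sup>2 else 0))"
    unfolding sym by (intro sum.cong refl) (auto simp: power2_eq_square C_def)
  also have "\<dots> = 2 * (\<Sum>i<n. \<Sum>j<n. C i j * v i * v j) + 2 * w 1 * (\<Sum>i<n. (v i)\<^sup>2)"
    by (simp add: sum.distrib sum_distrib_left mult_ac)
  finally have B: "toeplitz_form n w v v = (\<Sum>i<n. \<Sum>j<n. C i j * v i * v j) + w 1 * (\<Sum>i<n. (v i)\<^sup>2)"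
    by simp
  have diag: "(\<Sum>i<n. \<Sum>j<n. C i j * (v j)\<^sup>2) = (\<Sum>i<n. \<Sum>j<n. C i j * (v i)\<^sup>2)"
    using sum.swap[of "\<lambda>i j. C i j * (v j)\<^sup>2" "{..<n}" "{..<n}"] C_sym by simp
  have "(\<Sum>i<n. \<Sum>j<n. C i j * (v i - v j)\<^sup>2)
      = (\<Sum>i<n. \<Sum>j<n. C i j * (v i)\<^sup>2 + C i j * (v j)\<^sup>2 - 2 * (C i j * v i * v j))"
    by (intro sum.cong refl) (simp add: power2_eq_square algebra_simps)
  also have "\<dots> = 2 * (\<Sum>i<n. \<Sum>j<n. C i j * (v i)\<^sup>2) - 2 * (\<Sum>i<n. \<Sum>j<n. C i j * v i * v j)"
    by (simp add: sum.distrib sum_subtractf diag sum_distrib_left)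
  finally have pairs: "(\<Sum>i<n. \<Sum>j<n. C i j * (v i - v j)\<^sup>2) / 2
      = (\<Sum>i<n. \<Sum>j<n. C i j * (v i)\<^sup>2) - (\<Sum>i<n. \<Sum>j<n. C i j * v i * v j)"
    by simp
  show ?thesis
    unfolding B pairs
    by (simp add: left_diff_distrib sum_subtractf sum_distrib_left sum_distrib_right sum_negf)
qed

lemma toeplitz_form_convex_mult:
  assumes w: "0 \<le> w 0 + w 2" "\<And>k. 3 \<le> k \<Longrightarrow> 0 \<le> w k" "w sums 0"
    and e: "\<And>i. i < n \<Longrightarrow> 0 \<le> e i \<and> e i \<le> K"
    and convex: "midpoint_convex n e"
  shows "- toeplitz_form n w (\<lambda>i. e i * v i) (\<lambda>i. e i * v i)
    \<le> 2 * K\<^sup>2 * (- toeplitz_form n w v v)"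
proof -
  define C where "C = (\<lambda>i j. if i = j then 0 else lag_weight w ((i - j) + (j - i)))"
  define r where "r = (\<lambda>i. - w 1 - (\<Sum>j<n. C i j))"
  note lag = lag_weight_nonneg[of w, OF w(1,2)]
  have off_diag: "(\<Sum>j<n. C i j * f j)
      = (\<Sum>j\<in>{..<n} - {i}. lag_weight w ((i - j) + (j - i)) * f j)" for i and f :: "nat \<Rightarrow> real"
  proof -
    have "(\<Sum>j<n. C i j * f j) = (\<Sum>j\<in>{..<n} - {i}. C i j * f j)"
      by (rule sum.mono_neutral_right) (auto simp: C_def)
    also have "\<dots> = (\<Sum>j\<in>{..<n} - {i}. lag_weight w ((i - j) + (j - i)) * f j)"
      by (intro sum.cong) (auto simp: C_def)
    finally show ?thesis .
  qed
  have subharmonic: "(\<Sum>j<n. C i j * (f i - f j)) \<le> L * r i"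
    if "i < n" "\<And>j. j < n \<Longrightarrow> 0 \<le> f j \<and> f j \<le> L" "midpoint_convex n f" for i f L
    using convex_seq_almost_subharmonic[OF that(1) lag that(2,3) lag_weight_mass_le[of w n, OF w]]
      off_diag[of i "\<lambda>j. f i - f j"] off_diag[of i "\<lambda>_. 1"]
    by (simp add: r_def)
  have "(\<Sum>i<n. \<Sum>j<n. C i j * (e i * v i - e j * v j)\<^sup>2) / 2 + (\<Sum>i<n. r i * (e i * v i)\<^sup>2)
      \<le> 2 * K\<^sup>2 * ((\<Sum>i<n. \<Sum>j<n. C i j * (v i - v j)\<^sup>2) / 2 + (\<Sum>i<n. r i * (v i)\<^sup>2))"
  proof (rule dirichlet_energy_mult_le)
    show "0 \<le> C i j" for i j using lag by (auto simp: C_def)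
    show "C i j = C j i" for i j by (simp add: C_def add.commute)
    show "0 \<le> r i" if "i \<in> {..<n}" for i
      \<comment> \<open>The zero sequence with upper bound 1 leaves just the killing rate on the right.\<close>
      using subharmonic[of i "\<lambda>_. 0" 1] that by (simp add: midpoint_convex_def)
    show "(\<Sum>j<n. C i j * (e i - e j)) \<le> K * r i" if "i \<in> {..<n}" for i
      using subharmonic[OF _ e convex] that by simp
  qed (use e in auto)
  then show ?thesis
    unfolding neg_toeplitz_form_eq_dirichlet r_def C_def .
qed

section \<open>The symbol of a Toeplitz form\<close>

text \<open>
The exponent \<open>k - 1\<close> is \<open>i - j\<close> for the entry \<open>w k\<close> in position \<open>(i, j)\<close>, so that the entries of the
matrix are the Fourier coefficients of the symbol.
\<close>

definition symbol :: "(nat \<Rightarrow> real) \<Rightarrow> real \<Rightarrow> complex" where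
  "symbol w x = (\<Sum>k. of_real (w k) * cis ((real k - 1) * x))"

definition trig_poly :: "nat \<Rightarrow> (nat \<Rightarrow> real) \<Rightarrow> real \<Rightarrow> complex" where
  "trig_poly n u x = (\<Sum>j<n. of_real (u j) * cis (real j * x))"

lemma has_integral_cis_int:
  fixes m :: int
  shows "((\<lambda>x. cis (real_of_int m * x)) has_integral (if m = 0 then of_real (2 * pi) else 0)) {-pi..pi}"
proof (cases "m = 0")
  case True
  then show ?thesis
    using has_integral_const_real[of "1 :: complex" "-pi" pi] by (simp add: scaleR_conv_of_real)
next
  case False
  let ?F = "\<lambda>x. cis (real_of_int m * x) / (\<i> * of_int m)"
  have "((\<lambda>x. cis (real_of_int m * x)) has_integral (?F pi - ?F (-pi))) {-pi..pi}"
  proof (rule fundamental_theorem_of_calculus)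
    show "(?F has_vector_derivative cis (real_of_int m * x)) (at x within {-pi..pi})" for x
    proof -
      have "((\<lambda>z. exp (\<i> * of_int m * z) / (\<i> * of_int m)) has_field_derivative
          exp (\<i> * of_int m * of_real x)) (at (of_real x))"
        using False by (auto intro!: derivative_eq_intros)
      from has_vector_derivative_real_field[OF this] show ?thesis
        by (simp add: cis_conv_exp mult.assoc)
    qed
  qed auto
  moreover have "cis (real_of_int m * pi) = cis (real_of_int m * - pi)"
    by (simp add: complex_eq_iff sin_times_pi_eq_0)
  ultimately show ?thesis using False by (simp only: diff_self if_False)
qed

lemma symbol_fourier_coefficient:
  assumes summable: "summable (\<lambda>k. \<bar>w k\<bar>)"
  shows "((\<lambda>x. symbol w x * cis ((real j - real i) * x)) has_integral
    of_real (2 * pi * toeplitz_entry w i j)) {-pi..pi}"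
proof -
  let ?f = "\<lambda>k x. of_real (w k) * cis (real_of_int (int k - 1 + int j - int i) * x)"
  have shift: "of_real (w k) * cis ((real k - 1) * x) * cis ((real j - real i) * x) = ?f k x" for k x
  proof -
    have "(real k - 1) * x + (real j - real i) * x = real_of_int (int k - 1 + int j - int i) * x"
      by (simp add: algebra_simps)
    then show ?thesis by (metis (no_types) mult.assoc cis_mult)
  qed
  have product: "symbol w x * cis ((real j - real i) * x) = (\<Sum>k. ?f k x)" for x
  proof -
    have "summable (\<lambda>k. of_real (w k) * cis ((real k - 1) * x))"
      by (rule summable_norm_cancel) (simp add: norm_mult summable)
    from suminf_mult2[OF this, of "cis ((real j - real i) * x)"] show ?thesis
      by (simp only: symbol_def shift)
  qed
  have "uniform_limit {-pi..pi} (\<lambda>N x. \<Sum>k<N. ?f k x) (\<lambda>x. \<Sum>k. ?f k x) sequentially"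
    using summable by (intro Weierstrass_m_test) (auto simp: norm_mult)
  then obtain I J where I: "\<And>N. ((\<lambda>x. \<Sum>k<N. ?f k x) has_integral I N) {-pi..pi}"
    and J: "((\<lambda>x. \<Sum>k. ?f k x) has_integral J) {-pi..pi}" and lim: "I \<longlonglongrightarrow> J"
  proof (rule uniform_limit_integral)
    show "continuous_on {-pi..pi} (\<lambda>x. \<Sum>k<N. ?f k x)" for N
      by (intro continuous_intros)
  qed auto
  let ?c = "\<lambda>k. of_real (w k) * (if int k - 1 + int j - int i = 0 then of_real (2 * pi) else 0 :: complex)"
  have "((\<lambda>x. \<Sum>k<N. ?f k x) has_integral (\<Sum>k<N. ?c k)) {-pi..pi}" for N
    by (intro has_integral_sum has_integral_mult_right has_integral_cis_int) auto
  then have "I = (\<lambda>N. \<Sum>k<N. ?c k)"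
    using I has_integral_unique by blast
  with lim have "?c sums J" by (simp only: sums_def)
  moreover have "?c sums of_real (2 * pi * toeplitz_entry w i j)"
  proof (cases "j \<le> i + 1")
    case True
    then have "?c = (\<lambda>k. if k = i + 1 - j then of_real (2 * pi * w k) else 0)"
      by (auto simp: fun_eq_iff)
    then show ?thesis
      using sums_single[of "i + 1 - j" "\<lambda>k. complex_of_real (2 * pi * w k)"] True
      by (simp add: toeplitz_entry_def)
  next
    case False
    then have "?c = (\<lambda>_. 0)" by (auto simp: fun_eq_iff)
    then show ?thesis using False by (simp add: toeplitz_entry_def)
  qed
  ultimately show ?thesis
    using J sums_unique2 unfolding product by blast
qed

lemma toeplitz_form_as_integral:
  assumes "summable (\<lambda>k. \<bar>w k\<bar>)"
  shows "((\<lambda>x. symbol w x * (cnj (trig_poly n u x) * trig_poly n v x)) has_integral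
    of_real (2 * pi * toeplitz_form n w u v)) {-pi..pi}"
proof -
  have "((\<lambda>x. \<Sum>i<n. \<Sum>j<n. of_real (u i * v j) * (symbol w x * cis ((real j - real i) * x)))
      has_integral (\<Sum>i<n. \<Sum>j<n. of_real (u i * v j) * of_real (2 * pi * toeplitz_entry w i j))) {-pi..pi}"
    by (intro has_integral_sum has_integral_mult_right symbol_fourier_coefficient assms) auto
  moreover have "symbol w x * (cnj (trig_poly n u x) * trig_poly n v x)
      = (\<Sum>i<n. \<Sum>j<n. of_real (u i * v j) * (symbol w x * cis ((real j - real i) * x)))" for x
  proof -
    have "cis ((real j - real i) * x) = cis (- (real i * x)) * cis (real j * x)" for i j
      by (simp add: cis_mult algebra_simps)
    then have "of_real (u i * v j) * (symbol w x * cis ((real j - real i) * x))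
        = symbol w x * (cnj (of_real (u i) * cis (real i * x)) * (of_real (v j) * cis (real j * x)))"
      for i j by (simp only: complex_cnj_mult complex_cnj_complex_of_real cis_cnj of_real_mult mult_ac)
    then show ?thesis
      unfolding trig_poly_def cnj_sum unfolding sum_product unfolding sum_distrib_left
      by (simp only:)
  qed
  moreover have "(\<Sum>i<n. \<Sum>j<n. of_real (u i * v j) * of_real (2 * pi * toeplitz_entry w i j))
      = complex_of_real (2 * pi * toeplitz_form n w u v)"
    by (simp add: toeplitz_form_def sum_distrib_left mult_ac)
  ultimately show ?thesis by (simp only:)
qed

text \<open>
Under the integral sign the bound is \<open>2 s \<bar>g\<bar> \<bar>p\<bar> \<bar>q\<bar> \<le> Re (- g) (\<bar>p\<bar>\<^sup>2 + \<bar>q\<bar>\<^sup>2)\<close>, where \<open>p\<close> and \<open>q\<close> are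
the trigonometric polynomials of \<open>u\<close> and \<open>v\<close>: the sector condition combined with the inequality of
arithmetic and geometric means. The form with a sum rather than a product of energies suffices, as
\<open>u\<close> and \<open>v\<close> may be rescaled.
\<close>

lemma sectorial_symbol_bound:
  assumes summable: "summable (\<lambda>k. \<bar>w k\<bar>)"
    and s: "0 \<le> s"
    and sector: "\<And>x. x \<in> {-pi..pi} \<Longrightarrow> s * cmod (symbol w x) \<le> - Re (symbol w x)"
  shows "2 * s * \<bar>toeplitz_form n w u v\<bar> \<le> - toeplitz_form n w u u - toeplitz_form n w v v"
proof -
  let ?g = "symbol w" and ?p = "trig_poly n u" and ?q = "trig_poly n v"
  note int = toeplitz_form_as_integral[OF summable, of n]
  have f: "((\<lambda>x. of_real (2 * s) * (?g x * (cnj (?p x) * ?q x))) has_integral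
      of_real (2 * s) * of_real (2 * pi * toeplitz_form n w u v)) {-pi..pi}"
    by (intro has_integral_mult_right int)
  have energy: "((\<lambda>x. Re (?g x) * (cmod (trig_poly n y x))\<^sup>2) has_integral
      2 * pi * toeplitz_form n w y y) {-pi..pi}" for y
  proof -
    have "cnj z * z = of_real ((cmod z)\<^sup>2)" for z
      by (metis complex_norm_square mult.commute)
    then show ?thesis
      using has_integral_linear[OF int[of y y] bounded_linear_Re] by (simp add: o_def)
  qed
  let ?h = "\<lambda>x. - (Re (?g x) * (cmod (?p x))\<^sup>2) - Re (?g x) * (cmod (?q x))\<^sup>2"
  have h: "(?h has_integral - (2 * pi * toeplitz_form n w u u) - 2 * pi * toeplitz_form n w v v) {-pi..pi}"
    by (intro has_integral_diff has_integral_neg energy)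
  have bound: "cmod (of_real (2 * s) * (?g x * (cnj (?p x) * ?q x))) \<le> ?h x"
    if x: "x \<in> {-pi..pi}" for x
  proof -
    have "2 * (cmod (?p x) * cmod (?q x)) \<le> (cmod (?p x))\<^sup>2 + (cmod (?q x))\<^sup>2"
      using sum_squares_bound[of "cmod (?p x)" "cmod (?q x)"] by (simp add: mult_ac)
    moreover have "0 \<le> - Re (?g x)"
      using order_trans[OF mult_nonneg_nonneg[OF s norm_ge_zero] sector[OF x]] .
    ultimately have "s * cmod (?g x) * (2 * (cmod (?p x) * cmod (?q x)))
        \<le> - Re (?g x) * ((cmod (?p x))\<^sup>2 + (cmod (?q x))\<^sup>2)"
      using sector[OF x] by (intro mult_mono) auto
    then show ?thesis using s by (simp add: norm_mult algebra_simps)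
  qed
  have "cmod (of_real (2 * s) * of_real (2 * pi * toeplitz_form n w u v))
      \<le> - (2 * pi * toeplitz_form n w u u) - 2 * pi * toeplitz_form n w v v"
    unfolding integral_unique[OF f, symmetric] integral_unique[OF h, symmetric]
    by (rule integral_norm_bound_integral[OF has_integral_integrable[OF f] has_integral_integrable[OF h] bound])
  then have "pi * (2 * s * \<bar>toeplitz_form n w u v\<bar>)
      \<le> pi * (- toeplitz_form n w u u - toeplitz_form n w v v)"
    using s by (simp add: norm_mult abs_mult algebra_simps)
  then show ?thesis by simp
qed

section \<open>The weights and their generating function\<close>

lemma gl_coeff_pos:
  assumes "1 < \<alpha>" "\<alpha> < 2" "2 \<le> k"
  shows "0 < gl_coeff \<alpha> k"
  using assms(3)
proof (induction k rule: dec_induct)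
  case base
  then show ?case using assms(1,2) by (simp add: numeral_2_eq_2 field_simps zero_less_mult_iff)
next
  case (step k)
  then show ?case using assms(1,2) by (auto intro!: mult_pos_pos simp: field_simps)
qed

text \<open>
The recursion \<open>(k + 1) g\<^sub>k\<^sub>+\<^sub>1 = (k - \<alpha>) g\<^sub>k\<close> makes \<open>\<alpha> g\<^sub>k = k g\<^sub>k - (k + 1) g\<^sub>k\<^sub>+\<^sub>1\<close> telescope.
\<close>

lemma sum_gl_coeff: "\<alpha> * (\<Sum>k\<le>n. gl_coeff \<alpha> k) = - (real (Suc n) * gl_coeff \<alpha> (Suc n))"
proof (induction n)
  case (Suc n)
  have "real (Suc m) * gl_coeff \<alpha> (Suc m) = (real m - \<alpha>) * gl_coeff \<alpha> m" for m
    by (simp add: field_simps)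
  from this[of "Suc n"] Suc show ?case
    by (simp add: algebra_simps del: gl_coeff.simps(2))
qed simp

text \<open>
From index 2 on the coefficients are positive, so bounded partial sums suffice; by the telescoped
formula the full partial sums are eventually negative.
\<close>

lemma summable_abs_gl_coeff:
  assumes \<alpha>: "1 < \<alpha>" "\<alpha> < 2"
  shows "summable (\<lambda>k. \<bar>gl_coeff \<alpha> k\<bar>)"
proof -
  have "summable (\<lambda>k. gl_coeff \<alpha> (k + 2))"
  proof (rule bounded_imp_summable)
    show "0 \<le> gl_coeff \<alpha> (k + 2)" for k using gl_coeff_pos[OF \<alpha>, of "k + 2"] by simp
    fix n
    have "\<alpha> * (\<Sum>k\<le>n + 2. gl_coeff \<alpha> k) \<le> 0"
      unfolding sum_gl_coeff using gl_coeff_pos[OF \<alpha>, of "Suc (n + 2)"] by simp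
    then have "(\<Sum>k\<le>n + 2. gl_coeff \<alpha> k) \<le> 0"
      using \<alpha> by (simp add: mult_le_0_iff)
    moreover have "(\<Sum>k\<le>n + 2. gl_coeff \<alpha> k) = 1 - \<alpha> + (\<Sum>k\<le>n. gl_coeff \<alpha> (k + 2))"
      by (induction n) (auto simp: numeral_2_eq_2)
    ultimately show "(\<Sum>k\<le>n. gl_coeff \<alpha> (k + 2)) \<le> \<alpha> - 1" by simp
  qed
  then have "summable (\<lambda>k. \<bar>gl_coeff \<alpha> (k + 2)\<bar>)"
    using gl_coeff_pos[OF \<alpha>] by (simp add: abs_of_pos del: gl_coeff.simps)
  then show ?thesis by (subst (asm) summable_iff_shift)
qed

lemma summable_abs_w_coeff:
  assumes "1 < \<alpha>" "\<alpha> < 2"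
  shows "summable (\<lambda>k. \<bar>w_coeff \<alpha> k\<bar>)"
proof -
  note gl = summable_abs_gl_coeff[OF assms]
  have "summable (\<lambda>k. \<alpha> / 2 * \<bar>gl_coeff \<alpha> (Suc k)\<bar> + (2 - \<alpha>) / 2 * \<bar>gl_coeff \<alpha> k\<bar>)"
    using gl summable_Suc_iff[of "\<lambda>k. \<bar>gl_coeff \<alpha> k\<bar>"] by (intro summable_add summable_mult) blast+
  then have "summable (\<lambda>k. \<bar>w_coeff \<alpha> (Suc k)\<bar>)"
    by (rule summable_comparison_test_ev[rotated])
      (use assms in \<open>auto intro!: always_eventually order_trans[OF abs_triangle_ineq]
        simp: abs_mult simp del: gl_coeff.simps\<close>)
  then show ?thesis by (subst (asm) summable_Suc_iff)
qed

lemma w_coeff_sign: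
  assumes "1 < \<alpha>" "\<alpha> < 2"
  shows "0 \<le> w_coeff \<alpha> 0 + w_coeff \<alpha> 2" and "3 \<le> k \<Longrightarrow> 0 \<le> w_coeff \<alpha> k"
proof -
  have "w_coeff \<alpha> 0 + w_coeff \<alpha> 2 = \<alpha> * (\<alpha> - 1) * (\<alpha> + 2) / 4"
    by (simp add: numeral_2_eq_2 field_simps)
  also have "0 \<le> \<dots>" using assms by simp
  finally show "0 \<le> w_coeff \<alpha> 0 + w_coeff \<alpha> 2" .
  assume k: "3 \<le> k"
  then obtain l where l: "k = Suc l" "2 \<le> l" by (cases k) auto
  show "0 \<le> w_coeff \<alpha> k"
    using gl_coeff_pos[OF assms, of l] gl_coeff_pos[OF assms, of "Suc l"] l assms
    by (simp del: gl_coeff.simps)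
qed

lemma gl_coeff_eq_gbinomial: "complex_of_real (gl_coeff \<alpha> k) = (- 1) ^ k * (of_real \<alpha> gchoose k)"
proof (induction k)
  case (Suc k)
  have "of_nat (Suc k) * (of_real \<alpha> gchoose Suc k) = (of_real \<alpha> - of_nat k) * (of_real \<alpha> gchoose k :: complex)"
    using gbinomial_mult_1[of "of_real \<alpha> :: complex" k] by (simp add: algebra_simps)
  then have "(of_real \<alpha> gchoose Suc k) = (of_real \<alpha> - of_nat k) / of_nat (Suc k) * (of_real \<alpha> gchoose k :: complex)"
    by (simp add: field_simps del: of_nat_Suc)
  moreover have "complex_of_real (gl_coeff \<alpha> (Suc k))
      = (of_nat k - of_real \<alpha>) / of_nat (Suc k) * of_real (gl_coeff \<alpha> k)"
    by (simp add: field_simps)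
  ultimately show ?case using Suc by (simp add: field_simps)
qed simp

text \<open>
Inside the disc this is the binomial series. Both sides are continuous on the closed disc, the left
one by uniform convergence and the right one because \<open>\<alpha> > 0\<close> and \<open>1 - z\<close> stays in the
closed right half-plane; hence the identity extends to the circle, including \<open>z = 1\<close>.
\<close>

lemma gl_coeff_sums_powr:
  assumes \<alpha>: "1 < \<alpha>" "\<alpha> < 2" and z: "cmod z \<le> 1"
  shows "(\<lambda>k. of_real (gl_coeff \<alpha> k) * z ^ k) sums ((1 - z) powr of_real \<alpha>)"
proof -
  let ?f = "\<lambda>k z. complex_of_real (gl_coeff \<alpha> k) * z ^ k"
  note gl = summable_abs_gl_coeff[OF \<alpha>]
  have bound: "cmod (?f k z) \<le> \<bar>gl_coeff \<alpha> k\<bar>" if "z \<in> cball 0 1" for k z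
    using that by (auto simp: norm_mult norm_power intro!: mult_left_le power_le_one)
  have "continuous_on (cball 0 1) (\<lambda>z. \<Sum>k. ?f k z)"
  proof (rule uniform_limit_theorem)
    show "uniform_limit (cball 0 1) (\<lambda>n z. \<Sum>k<n. ?f k z) (\<lambda>z. \<Sum>k. ?f k z) sequentially"
      by (rule Weierstrass_m_test[OF bound gl])
  qed (auto intro!: always_eventually continuous_intros)
  moreover have "continuous_on (cball 0 1) (\<lambda>z :: complex. (1 - z) powr of_real \<alpha>)"
  proof (intro continuous_intros)
    show "cball 0 1 \<subseteq> {z. 0 \<le> Re (1 - z) \<or> Im (1 - z) \<noteq> 0}"
      using complex_Re_le_cmod order_trans by fastforce
  qed (use \<alpha> in auto)
  ultimately have "continuous_on (closure (ball 0 1))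
      (\<lambda>z :: complex. (\<Sum>k. ?f k z) - (1 - z) powr of_real \<alpha>)"
    by (simp add: continuous_on_diff)
  moreover have "(\<Sum>k. ?f k y) - (1 - y) powr of_real \<alpha> = 0" if "y \<in> ball 0 1" for y
  proof -
    have "(\<lambda>k. (of_real \<alpha> gchoose k) * (- y) ^ k) sums (1 + - y) powr of_real \<alpha>"
      using that by (intro gen_binomial_complex) simp
    also have "(\<lambda>k. (of_real \<alpha> gchoose k) * (- y) ^ k) = (\<lambda>k. ?f k y)"
      by (simp add: gl_coeff_eq_gbinomial power_minus[of y] mult_ac)
    finally show ?thesis by (simp add: sums_iff)
  qed
  moreover have "z \<in> closure (ball 0 1)" using z by simp
  ultimately have "(\<Sum>k. ?f k z) - (1 - z) powr of_real \<alpha> = 0"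
    by (rule continuous_constant_on_closure)
  moreover have "summable (\<lambda>k. ?f k z)"
    by (rule summable_norm_cancel, rule summable_comparison_test_ev[OF _ gl])
      (use z bound in auto)
  ultimately show ?thesis by (simp add: sums_iff)
qed

lemma w_coeff_sums_powr:
  assumes \<alpha>: "1 < \<alpha>" "\<alpha> < 2" and z: "cmod z \<le> 1"
  shows "(\<lambda>k. of_real (w_coeff \<alpha> k) * z ^ k) sums
    ((of_real (\<alpha> / 2) + of_real (1 - \<alpha> / 2) * z) * (1 - z) powr of_real \<alpha>)"
proof -
  let ?G = "(1 - z) powr of_real \<alpha>"
  note gl = gl_coeff_sums_powr[OF assms]
  have "(\<lambda>k. of_real (gl_coeff \<alpha> (Suc k)) * z ^ Suc k) sums (?G - 1)"
    using gl by (subst sums_Suc_iff) simp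
  then have "(\<lambda>k. of_real (\<alpha> / 2) * (of_real (gl_coeff \<alpha> (Suc k)) * z ^ Suc k)
      + of_real (1 - \<alpha> / 2) * z * (of_real (gl_coeff \<alpha> k) * z ^ k))
      sums (of_real (\<alpha> / 2) * (?G - 1) + of_real (1 - \<alpha> / 2) * z * ?G)"
    using gl by (intro sums_add sums_mult)
  moreover have "of_real (w_coeff \<alpha> (Suc k)) * z ^ Suc k
      = of_real (\<alpha> / 2) * (of_real (gl_coeff \<alpha> (Suc k)) * z ^ Suc k)
      + of_real (1 - \<alpha> / 2) * z * (of_real (gl_coeff \<alpha> k) * z ^ k)" for k
    by (simp add: diff_divide_distrib algebra_simps del: gl_coeff.simps)
  ultimately have "(\<lambda>k. of_real (w_coeff \<alpha> (Suc k)) * z ^ Suc k)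
      sums (of_real (\<alpha> / 2) * (?G - 1) + of_real (1 - \<alpha> / 2) * z * ?G)"
    by simp
  then show ?thesis
    by (subst (asm) sums_Suc_iff) (simp add: algebra_simps)
qed

lemma w_coeff_sums_0:
  assumes "1 < \<alpha>" "\<alpha> < 2"
  shows "w_coeff \<alpha> sums 0"
proof -
  have "(\<lambda>k. complex_of_real (w_coeff \<alpha> k)) sums of_real 0"
    using w_coeff_sums_powr[OF assms, of 1] by simp
  then show ?thesis by (simp only: sums_of_real_iff)
qed

lemma gen_fun_eq_symbol: "gen_fun \<alpha> = symbol (w_coeff \<alpha>)"
  by (simp add: fun_eq_iff gen_fun_def symbol_def cis_conv_exp)

lemma symbol_eq_powr:
  assumes "1 < \<alpha>" "\<alpha> < 2"
  shows "symbol (w_coeff \<alpha>) x = cis (- x) *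
    ((of_real (\<alpha> / 2) + of_real (1 - \<alpha> / 2) * cis x) * (1 - cis x) powr of_real \<alpha>)"
proof -
  have "(\<lambda>k. cis (- x) * (of_real (w_coeff \<alpha> k) * cis x ^ k)) sums (cis (- x) *
      ((of_real (\<alpha> / 2) + of_real (1 - \<alpha> / 2) * cis x) * (1 - cis x) powr of_real \<alpha>))"
    using assms by (intro sums_mult w_coeff_sums_powr) auto
  moreover have "cis (- x) * (of_real (w_coeff \<alpha> k) * cis x ^ k)
      = of_real (w_coeff \<alpha> k) * cis ((real k - 1) * x)" for k
  proof -
    have "- x + real k * x = (real k - 1) * x" by (simp add: algebra_simps)
    then have "cis (- x) * cis x ^ k = cis ((real k - 1) * x)"
      by (simp only: Complex.DeMoivre cis_mult)
    then show ?thesis by (simp add: mult.left_commute)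
  qed
  ultimately show ?thesis by (simp add: symbol_def sums_iff)
qed

text \<open>
On the upper half of the circle \<open>1 - e\<^sup>i\<^sup>x = 2 sin (x/2) e\<^sup>i\<^sup>(\<^sup>x\<^sup>-\<^sup>\<pi>\<^sup>)\<^sup>/\<^sup>2\<close>, and the angle lies in the
range of the principal branch.
\<close>

lemma one_minus_cis_powr:
  assumes "0 < x" "x \<le> pi"
  shows "(1 - cis x) powr of_real \<alpha> = of_real ((2 * sin (x / 2)) powr \<alpha>) * cis (\<alpha> * (x - pi) / 2)"
proof -
  let ?\<theta> = "(x - pi) / 2"
  have sin_pos: "0 < sin (x / 2)" using assms by (intro sin_gt_zero) auto
  have "1 - cis x = of_real (2 * sin (x / 2)) * cis ?\<theta>"
  proof -
    have "?\<theta> = x / 2 - pi / 2" by (simp add: field_simps)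
    then have cs: "cos ?\<theta> = sin (x / 2)" "sin ?\<theta> = - cos (x / 2)"
      by (simp_all only: cos_diff sin_diff) simp_all
    have "cos x = 1 - 2 * (sin (x / 2))\<^sup>2" "sin x = 2 * sin (x / 2) * cos (x / 2)"
      using cos_double_sin[of "x / 2"] sin_double[of "x / 2"] by simp_all
    then show ?thesis using cs by (simp add: complex_eq_iff power2_eq_square)
  qed
  also have "\<dots> = exp (of_real (ln (2 * sin (x / 2))) + \<i> * of_real ?\<theta>)"
    using sin_pos by (simp add: exp_add cis_conv_exp exp_of_real)
  finally have polar: "1 - cis x = exp (of_real (ln (2 * sin (x / 2))) + \<i> * of_real ?\<theta>)" .
  have "Ln (1 - cis x) = of_real (ln (2 * sin (x / 2))) + \<i> * of_real ?\<theta>"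
    unfolding polar using assms pi_gt_zero by (intro Ln_exp) auto
  moreover have "1 - cis x \<noteq> 0" unfolding polar by simp
  ultimately show ?thesis
    using sin_pos
    by (simp add: powr_def exp_of_real[symmetric] cis_conv_exp exp_add[symmetric] algebra_simps)
qed

text \<open>
With \<open>a = \<alpha>/2\<close>, \<open>b = 1 - a\<close> and \<open>y = \<pi> - x\<close> the closed form becomes, up to a positive factor,
\<open>- g = a e\<^sup>i\<^sup>b\<^sup>y - b e\<^sup>-\<^sup>i\<^sup>a\<^sup>y\<close>. Its modulus is at most \<open>a + b = 1\<close>, and since \<open>b < a\<close> its real part
\<open>a cos (b y) - b cos (a y)\<close> is at least \<open>(a - b) cos (b y) \<ge> (a - b) cos (b \<pi>)\<close>, which is positive as
\<open>b < 1/2\<close>. This lower bound for the ratio is not sharp, but it does not depend on \<open>x\<close>.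
\<close>

lemma symbol_sector_pos:
  assumes \<alpha>: "1 < \<alpha>" "\<alpha> < 2" and x: "0 < x" "x \<le> pi"
  shows "(\<alpha> - 1) * cos ((1 - \<alpha> / 2) * pi) * cmod (symbol (w_coeff \<alpha>) x)
      \<le> - Re (symbol (w_coeff \<alpha>) x)"
    and "symbol (w_coeff \<alpha>) x \<noteq> 0"
proof -
  define a b where "a = \<alpha> / 2" and "b = 1 - \<alpha> / 2"
  define y where "y = pi - x"
  define R where "R = (2 * sin (x / 2)) powr \<alpha>"
  let ?g = "symbol (w_coeff \<alpha>) x"
  have ab: "0 < b" "b < a" "a < 1" "a - b = \<alpha> - 1" "a + b = 1" "b < 1 / 2"
    using \<alpha> by (auto simp: a_def b_def)
  have y: "0 \<le> y" "y \<le> pi" using x by (auto simp: y_def)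
  have "0 < sin (x / 2)" using x by (intro sin_gt_zero) auto
  then have R: "0 < R" by (simp add: R_def)
  have "?g = of_real R * (of_real a * (cis (- x) * cis (\<alpha> * (x - pi) / 2))
      + of_real b * (cis (- x) * cis x * cis (\<alpha> * (x - pi) / 2)))"
    unfolding symbol_eq_powr[OF \<alpha>] one_minus_cis_powr[OF x] R_def a_def b_def
    by (simp add: algebra_simps)
  also have "\<dots> = of_real R * (of_real a * cis (b * y - pi) + of_real b * cis (- (a * y)))"
  proof -
    have "- x + \<alpha> * (x - pi) / 2 = b * y - pi" "\<alpha> * (x - pi) / 2 = - (a * y)"
      by (simp_all add: a_def b_def y_def field_simps)
    then show ?thesis by (simp add: cis_mult)
  qed
  finally have g: "?g = of_real R * (of_real a * cis (b * y - pi) + of_real b * cis (- (a * y)))" .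
  have Re: "- Re ?g = R * (a * cos (b * y) - b * cos (a * y))"
    unfolding g by (simp add: cos_diff algebra_simps)
  have "cmod ?g \<le> R * (a + b)"
    unfolding g using ab R
    by (auto simp: norm_mult intro!: mult_left_mono order_trans[OF norm_triangle_ineq])
  then have norm_le: "cmod ?g \<le> R" using ab by simp
  have args: "b * y \<le> b * pi" "b * pi < pi / 2" "b * y \<le> a * y" "a * y \<le> pi"
    using ab y mult_mono[of a 1 y pi] by (auto intro: mult_left_mono mult_right_mono)
  have cos_mono: "cos (b * pi) \<le> cos (b * y)" "cos (a * y) \<le> cos (b * y)"
    using args ab y by (auto intro!: cos_monotone_0_pi_le)
  have "0 < b * pi" using ab by simp
  then have cos_pos: "0 < cos (b * pi)" using args(2) by (intro cos_gt_zero_pi) linarith+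
  have "(a - b) * cos (b * pi) \<le> (a - b) * cos (b * y)"
    using cos_mono ab by (intro mult_left_mono) auto
  also have "\<dots> \<le> a * cos (b * y) - b * cos (a * y)"
    using mult_left_mono[OF cos_mono(2), of b] ab by (simp add: algebra_simps)
  finally have lower: "(a - b) * cos (b * pi) \<le> a * cos (b * y) - b * cos (a * y)" .
  have \<delta>: "0 < (a - b) * cos (b * pi)" using cos_pos ab by simp
  have "(a - b) * cos (b * pi) * cmod ?g \<le> (a - b) * cos (b * pi) * R"
    using norm_le \<delta> by (intro mult_left_mono) auto
  also have "\<dots> \<le> - Re ?g"
    unfolding Re using mult_right_mono[OF lower, of R] R by (simp add: mult_ac)
  finally show "(\<alpha> - 1) * cos ((1 - \<alpha> / 2) * pi) * cmod ?g \<le> - Re ?g"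
    unfolding ab(4) unfolding b_def .
  have "0 < - Re ?g" unfolding Re using lower \<delta> R by (intro mult_pos_pos) auto
  then show "?g \<noteq> 0" by auto
qed

lemma symbol_minus: "symbol w (- x) = cnj (symbol w x)" if "summable (\<lambda>k. \<bar>w k\<bar>)"
proof -
  have "summable (\<lambda>k. of_real (w k) * cis ((real k - 1) * x))"
    by (rule summable_norm_cancel) (simp add: norm_mult that)
  then have "(\<lambda>k. of_real (w k) * cis ((real k - 1) * x)) sums symbol w x"
    by (simp add: symbol_def summable_sums)
  then have "(\<lambda>k. cnj (of_real (w k) * cis ((real k - 1) * x))) sums cnj (symbol w x)"
    by (simp only: sums_cnj)
  then show ?thesis by (simp add: symbol_def cis_cnj sums_iff)
qed

text \<open>
The bound on the upper half circle passes to the lower half by conjugation and then to the infimum.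
The point \<open>x = 0\<close>, which the infimum leaves out, is harmless because the symbol vanishes there.
\<close>

lemma varsigma_sector:
  assumes \<alpha>: "1 < \<alpha>" "\<alpha> < 2"
  shows "0 < varsigma \<alpha>"
    and "x \<in> {-pi..pi} \<Longrightarrow> varsigma \<alpha> * cmod (symbol (w_coeff \<alpha>) x) \<le> - Re (symbol (w_coeff \<alpha>) x)"
proof -
  let ?g = "symbol (w_coeff \<alpha>)"
  define \<delta> where "\<delta> = (\<alpha> - 1) * cos ((1 - \<alpha> / 2) * pi)"
  have "0 < \<delta>"
    unfolding \<delta>_def using \<alpha>
    by (intro mult_pos_pos cos_gt_zero) (auto simp: field_simps)
  have sector: "\<delta> * cmod (?g x) \<le> - Re (?g x) \<and> ?g x \<noteq> 0" if "x \<in> {-pi..pi} - {0}" for x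
  proof (cases "0 < x")
    case True
    then show ?thesis using symbol_sector_pos[OF \<alpha>, of x] that by (simp add: \<delta>_def)
  next
    case False
    have "?g x = cnj (?g (- x))"
      using symbol_minus[OF summable_abs_w_coeff[OF \<alpha>], of x] by simp
    then show ?thesis using symbol_sector_pos[OF \<alpha>, of "- x"] that False by (simp add: \<delta>_def)
  qed
  have ratio: "\<delta> \<le> Re (- gen_fun \<alpha> x) / cmod (gen_fun \<alpha> x)" if "x \<in> {-pi..pi} - {0}" for x
    unfolding gen_fun_eq_symbol using sector[OF that] by (subst pos_le_divide_eq) auto
  have "pi \<in> {-pi..pi} - {0}" by simp
  then have "\<delta> \<le> varsigma \<alpha>"
    unfolding varsigma_def using ratio by (intro cINF_greatest) blast+
  with \<open>0 < \<delta>\<close> show "0 < varsigma \<alpha>" by simp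
  assume x: "x \<in> {-pi..pi}"
  show "varsigma \<alpha> * cmod (?g x) \<le> - Re (?g x)"
  proof (cases "x = 0")
    case True
    have "?g 0 = 0" using symbol_eq_powr[OF \<alpha>, of 0] by simp
    then show ?thesis using True by simp
  next
    case False
    have "varsigma \<alpha> \<le> Re (- gen_fun \<alpha> x) / cmod (gen_fun \<alpha> x)"
      unfolding varsigma_def using ratio x False by (intro cINF_lower bdd_belowI2[of _ \<delta>]) blast+
    then show ?thesis
      unfolding gen_fun_eq_symbol using sector[of x] x False by (subst (asm) pos_le_divide_eq) auto
  qed
qed

section \<open>Negative semidefiniteness\<close>

text \<open>
Rescaling \<open>v\<close> by \<open>\<surd>2 K\<close> before using the sector bound balances the two energies, because the
energy of \<open>e v\<close> is at most \<open>2 K\<^sup>2\<close> times that of \<open>v\<close>.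
\<close>

lemma perturbed_form_le_0:
  assumes \<alpha>: "1 < \<alpha>" "\<alpha> < 2"
    and e: "\<And>i. i < n \<Longrightarrow> 0 \<le> e i \<and> e i \<le> K"
    and convex: "midpoint_convex n e"
    and K: "0 \<le> K"
    and \<sigma>: "\<bar>\<sigma>\<bar> = 1"
    and cond: "0 \<le> 1 + \<kappa> - sqrt 2 * K / varsigma \<alpha>"
  defines "B \<equiv> toeplitz_form n (w_coeff \<alpha>)"
  shows "(1 + \<kappa>) * B v v + \<sigma> * B v (\<lambda>i. e i * v i) \<le> 0"
proof -
  let ?s = "varsigma \<alpha>" and ?ev = "\<lambda>i. e i * v i"
  note s = varsigma_sector[OF \<alpha>]
  have sector: "2 * ?s * \<bar>B u y\<bar> \<le> - B u u - B y y" for u y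
    unfolding B_def
    using sectorial_symbol_bound[OF summable_abs_w_coeff[OF \<alpha>] less_imp_le[OF s(1)] s(2)] by blast
  have energy: "- B ?ev ?ev \<le> 2 * K\<^sup>2 * (- B v v)"
    unfolding B_def
    by (intro toeplitz_form_convex_mult w_coeff_sign w_coeff_sums_0 \<alpha> e convex)
  have scale: "B (\<lambda>i. c * v i) y = c * B v y" "B (\<lambda>i. c * v i) (\<lambda>i. c * v i) = c\<^sup>2 * B v v" for c y
    by (simp_all add: B_def toeplitz_form_def sum_distrib_left power2_eq_square mult_ac)
  have Q: "0 \<le> - B v v" using sector[of v v] s(1)
    by (smt (verit) mult_nonneg_nonneg)
  \<comment> \<open>For \<open>K = 0\<close> the rescaling degenerates, but then \<open>e\<close> vanishes.\<close>
  have B_ev: "?s * \<bar>B v ?ev\<bar> \<le> sqrt 2 * K * (- B v v)"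
  proof (cases "K = 0")
    case True
    then have "e i = 0" if "i < n" for i using e[OF that] by simp
    then have "B v ?ev = 0" by (simp add: B_def toeplitz_form_def)
    then show ?thesis using True by simp
  next
    case False
    let ?c = "sqrt 2 * K"
    have c: "0 < ?c" using False K by simp
    have "2 * ?s * (?c * \<bar>B v ?ev\<bar>) \<le> - (?c\<^sup>2 * B v v) - B ?ev ?ev"
      using sector[of "\<lambda>i. ?c * v i" ?ev]
      unfolding scale(2) unfolding scale(1) unfolding abs_mult[of ?c] abs_of_pos[OF c] .
    also have "\<dots> \<le> 2 * (?c * (?c * (- B v v)))"
      using energy by (simp add: power_mult_distrib power2_eq_square)
    finally have "?c * (?s * \<bar>B v ?ev\<bar>) \<le> ?c * (?c * (- B v v))"
      by (simp add: mult_ac)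
    then show ?thesis using c by (simp only: mult_le_cancel_left_pos)
  qed
  have "\<sigma> * B v ?ev \<le> \<bar>B v ?ev\<bar>" using \<sigma> by (metis abs_ge_self abs_mult mult_1)
  also have "\<dots> \<le> sqrt 2 * K * (- B v v) / ?s" 
    using B_ev unfolding pos_le_divide_eq[OF s(1)] by (subst mult.commute)
  finally have "(1 + \<kappa>) * B v v + \<sigma> * B v ?ev
      \<le> - ((1 + \<kappa> - sqrt 2 * K / ?s) * (- B v v))"
    by (simp add: algebra_simps)
  also have "\<dots> \<le> 0" using mult_nonneg_nonneg[OF cond Q] by simp
  finally show ?thesis .
qed

lemma quadratic_form_sym_part:
  assumes A: "A \<in> carrier_mat n n" and v: "v \<in> carrier_vec n"
  shows "v \<bullet> (sym_part A *\<^sub>v v) = v \<bullet> (A *\<^sub>v v)"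
proof -
  have "v \<bullet> (A *\<^sub>v v) = (\<Sum>i<n. \<Sum>j<n. vec_index v i * (A $$ (i, j) * vec_index v j))"
    using assms by (simp add: scalar_prod_def sum_distrib_left lessThan_atLeast0)
  moreover have "v \<bullet> (sym_part A *\<^sub>v v)
      = (\<Sum>i<n. \<Sum>j<n. vec_index v i * ((A $$ (i, j) + A $$ (j, i)) / 2 * vec_index v j))"
    using assms by (simp add: sym_part_def scalar_prod_def sum_distrib_left lessThan_atLeast0)
  moreover have "\<dots> = ((\<Sum>i<n. \<Sum>j<n. vec_index v i * (A $$ (i, j) * vec_index v j))
      + (\<Sum>i<n. \<Sum>j<n. vec_index v j * (A $$ (j, i) * vec_index v i))) / 2"
    by (simp add: sum.distrib[symmetric] sum_divide_distrib algebra_simps add_divide_distrib)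
  ultimately show ?thesis
    using sum.swap[of "\<lambda>i j. vec_index v i * (A $$ (i, j) * vec_index v j)" "{..<n}" "{..<n}"] by simp
qed

lemma A_mat_carrier: "A_mat \<alpha> xL xR M d \<in> carrier_mat (M - 1) (M - 1)"
  unfolding carrier_mat_def by (simp add: A_mat_def W_mat_def D_mat_def mat_diag_def)

lemma quadratic_form_A_mat:
  fixes \<alpha> :: real
  assumes v: "v \<in> carrier_vec (M - 1)"
  defines "B \<equiv> toeplitz_form (M - 1) (w_coeff \<alpha>)"
  shows "v \<bullet> (A_mat \<alpha> xL xR M d *\<^sub>v v) = B (vec_index v) (vec_index v)
    + B (vec_index v) (\<lambda>i. d (grid_point xL xR M (i + 1)) * vec_index v i)"
proof -
  let ?n = "M - 1" and ?T = "toeplitz_entry (w_coeff \<alpha>)"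
    and ?d = "\<lambda>i. d (grid_point xL xR M (i + 1))" and ?v = "vec_index v"
  have W: "W_mat \<alpha> M = mat ?n ?n (\<lambda>(i, j). ?T i j)"
    by (simp add: W_mat_def toeplitz_entry_def)
  have entry: "A_mat \<alpha> xL xR M d $$ (i, j) = ?T i j + ?d i * ?T j i" if "i < ?n" "j < ?n" for i j
    using that unfolding A_mat_def D_mat_def W
    by (subst mat_diag_mult_left[of _ ?n ?n]) auto
  have "v \<bullet> (A_mat \<alpha> xL xR M d *\<^sub>v v)
      = (\<Sum>i<?n. \<Sum>j<?n. ?v i * (A_mat \<alpha> xL xR M d $$ (i, j) * ?v j))"
    using A_mat_carrier[of \<alpha> xL xR M d] v
    by (auto simp add: scalar_prod_def sum_distrib_left lessThan_atLeast0)
  also have "\<dots> = (\<Sum>i<?n. \<Sum>j<?n. ?v i * ?T i j * ?v j + ?v j * ?T j i * (?d i * ?v i))"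
    by (intro sum.cong refl) (simp add: entry algebra_simps)
  also have "\<dots> = B ?v ?v + (\<Sum>i<?n. \<Sum>j<?n. ?v j * ?T j i * (?d i * ?v i))"
    by (simp add: B_def toeplitz_form_def sum.distrib)
  also have "(\<Sum>i<?n. \<Sum>j<?n. ?v j * ?T j i * (?d i * ?v i)) = B ?v (\<lambda>i. ?d i * ?v i)"
    unfolding B_def toeplitz_form_def by (rule sum.swap)
  finally show ?thesis .
qed

lemma grid_point_mem:
  assumes "xL < xR" "0 < M" "i \<le> M"
  shows "grid_point xL xR M i \<in> {xL..xR}"
proof -
  have "real i * ((xR - xL) / real M) \<le> real M * ((xR - xL) / real M)"
    using assms by (intro mult_right_mono) auto
  then show ?thesis using assms by (simp add: grid_point_def)
qed

lemma convex_on_grid: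
  assumes f: "convex_on {xL..xR} f" and "xL < xR" "0 < M"
  shows "midpoint_convex (M - 1) (\<lambda>i. f (grid_point xL xR M (i + 1)))"
  unfolding midpoint_convex_def
proof (intro allI impI)
  fix i k :: nat
  assume ik: "k \<le> i \<and> i + k < M - 1"
  let ?x = "\<lambda>i. grid_point xL xR M (i + 1)"
  have "?x i = (1 - 1 / 2) *\<^sub>R ?x (i - k) + (1 / 2) *\<^sub>R ?x (i + k)"
  proof -
    define h where "h = (xR - xL) / real M"
    show ?thesis
      unfolding grid_point_def h_def[symmetric] using ik by (simp add: of_nat_diff algebra_simps)
  qed
  moreover have "?x (i - k) \<in> {xL..xR}" "?x (i + k) \<in> {xL..xR}"
    using ik assms by (intro grid_point_mem; simp)+
  ultimately show "2 * f (?x i) \<le> f (?x (i - k)) + f (?x (i + k))"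
    using convex_onD[OF f, of "1 / 2" "?x (i - k)" "?x (i + k)"] by simp
qed

theorem theorem3p5:
  fixes \<alpha> xL xR \<kappa> \<kappa>min \<kappa>max :: real
    and M :: nat
    and d_plus d_minus d_tilde :: "real \<Rightarrow> real"
  assumes alpha: "1 < \<alpha>" "\<alpha> < 2"
    and interval: "xL < xR"
    and M_pos: "0 < M"
    and d_plus_pos: "\<And>x. x \<in> {xL..xR} \<Longrightarrow> 0 < d_plus x"
    and d_minus_nonneg: "\<And>x. x \<in> {xL..xR} \<Longrightarrow> 0 \<le> d_minus x"
    and d_tilde: "\<And>x. x \<in> {xL..xR} \<Longrightarrow> d_tilde x = d_minus x / d_plus x"
    and kmin_nonneg: "0 \<le> \<kappa>min"
    and bounds: "\<And>x. x \<in> {xL..xR} \<Longrightarrow> \<kappa>min \<le> d_tilde x \<and> d_tilde x \<le> \<kappa>max"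
    and kappa: "(concave_on {xL..xR} d_tilde \<and> \<kappa> = \<kappa>max)
              \<or> (convex_on {xL..xR} d_tilde \<and> \<kappa> = \<kappa>min)"
    and cond: "1 + \<kappa> - sqrt 2 * (\<kappa>max - \<kappa>min) / varsigma \<alpha> \<ge> 0"
  shows "neg_semidef (M - 1) (sym_part (A_mat \<alpha> xL xR M d_tilde))"
proof -
  let ?A = "A_mat \<alpha> xL xR M d_tilde" and ?n = "M - 1"
  let ?x = "\<lambda>i. grid_point xL xR M (i + 1)"
  note carrier = A_mat_carrier[of \<alpha> xL xR M d_tilde]
  have K: "0 \<le> \<kappa>max - \<kappa>min" using bounds[of xL] interval by simp
  obtain \<sigma> f where \<sigma>: "\<bar>\<sigma>\<bar> = 1" and f: "convex_on {xL..xR} f"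
    and f_bounds: "\<And>x. x \<in> {xL..xR} \<Longrightarrow> 0 \<le> f x \<and> f x \<le> \<kappa>max - \<kappa>min"
    and split: "\<And>x. d_tilde x = \<kappa> + \<sigma> * f x"
  proof -
    have cc: "convex_on {xL..xR} (\<lambda>_. c)" for c :: real by (simp add: convex_on_const)
    from kappa show thesis
    proof
      assume *: "concave_on {xL..xR} d_tilde \<and> \<kappa> = \<kappa>max"
      then have "convex_on {xL..xR} (\<lambda>x. \<kappa>max + - d_tilde x)"
        by (intro convex_on_add cc) (simp add: concave_on_def)
      then show thesis
        using that[of "- 1" "\<lambda>x. \<kappa>max - d_tilde x"] bounds * by simp
    next
      assume *: "convex_on {xL..xR} d_tilde \<and> \<kappa> = \<kappa>min"
      then have "convex_on {xL..xR} (\<lambda>x. d_tilde x + - \<kappa>min)"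
        by (intro convex_on_add cc) simp
      then show thesis
        using that[of 1 "\<lambda>x. d_tilde x - \<kappa>min"] bounds * by simp
    qed
  qed
  have "v \<bullet> (sym_part ?A *\<^sub>v v) \<le> 0" if v: "v \<in> carrier_vec ?n" for v
  proof -
    let ?B = "toeplitz_form ?n (w_coeff \<alpha>)" and ?v = "vec_index v"
    have "v \<bullet> (sym_part ?A *\<^sub>v v) = ?B ?v ?v + ?B ?v (\<lambda>i. d_tilde (?x i) * ?v i)"
      using quadratic_form_sym_part[OF carrier v] quadratic_form_A_mat[OF v] by simp
    also have "\<dots> = (1 + \<kappa>) * ?B ?v ?v + \<sigma> * ?B ?v (\<lambda>i. f (?x i) * ?v i)"
      unfolding split toeplitz_form_def
      by (simp add: algebra_simps sum.distrib sum_distrib_left)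
    also have "\<dots> \<le> 0"
    proof (rule perturbed_form_le_0[OF alpha _ convex_on_grid[OF f interval M_pos] K \<sigma> cond])
      fix i assume "i < ?n"
      then have "?x i \<in> {xL..xR}" using interval M_pos by (intro grid_point_mem) auto
      then show "0 \<le> f (?x i) \<and> f (?x i) \<le> \<kappa>max - \<kappa>min" by (rule f_bounds)
    qed
    finally show ?thesis .
  qed
  moreover have "sym_part ?A \<in> carrier_mat ?n ?n"
    using carrier by (simp add: sym_part_def)
  moreover have "transpose_mat (sym_part ?A) = sym_part ?A"
    using carrier by (intro eq_matI) (auto simp: sym_part_def)
  ultimately show ?thesis by (simp add: neg_semidef_def)
qed

end
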